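(* Let $k\in\mathbb N$ and $f\in\mathrm{PCC}^k(\Omega)$. Then there exists a periodic $\omega\in\Omega$ (i.e. $\sigma^p\omega=\omega$ for some $p\ge1$) such that $\lim_{N\to\infty}\frac1N\sum_{n=1}^N f(\sigma^n\omega)=\alpha_{f,\max}^*$.
   Context: $\Omega=\{0,1\}^{\mathbb N}$ ($\mathbb N=\{1,2,\dots\}$) with the product topology; $\sigma:\Omega\to\Omega$ is the one-sided shift, $(\sigma\omega)_k=\omega_{k+1}$. $C(\Omega)$ is the space of continuous functions $\Omega\to\mathbb R$. $\mathrm{PCC}^k(\Omega)$ is the set of functions $f\in C(\Omega)$ such that $f(\omega)$ depends only on the first $k$ coordinates $\omega_1,\dots,\omega_k$. For $f\in C(\Omega)$ and $\alpha\in\mathbb R$, $E_f(\alpha)=\{\omega\in\Omega:\lim_{N\to\infty}\frac1N\sum_{n=1}^N f(\sigma^n\omega)=\alpha\}$, and $\alpha_{f,\max}^*=\sup\{\alpha\in\mathbb R:E_f(\alpha)\ne\emptyset\}$. *)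

theory Defs
  imports "HOL-Analysis.Analysis"
begin

(* The alphabet {0,1} is represented by bool, which carries the discrete topology; the topology
   that HOL-Analysis puts on the function type is then the product topology. Indices start
   at 0: the coordinate written omega_i in the usual 1-based convention is \<omega> (i - 1). *)
type_synonym bitseq = "nat \<Rightarrow> bool"

definition shift :: "bitseq \<Rightarrow> bitseq" where
  "shift \<omega> = (\<lambda>i. \<omega> (Suc i))"

definition PCC :: "nat \<Rightarrow> (bitseq \<Rightarrow> real) set" where
  "PCC k = {f. continuous_on UNIV f \<and>
              (\<forall>\<omega> \<eta>. (\<forall>i<k. \<omega> i = \<eta> i) \<longrightarrow> f \<omega> = f \<eta>)}"

(* The sum runs over n = 1, ..., N, so it starts at the first shift of \<omega> and not at \<omega>.
   The value at N = 0 is 0 / 0 = 0 and plays no role in limits. *)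
definition birkhoff_avg :: "(bitseq \<Rightarrow> real) \<Rightarrow> bitseq \<Rightarrow> nat \<Rightarrow> real" where
  "birkhoff_avg f \<omega> N = (1 / real N) * (\<Sum>n=1..N. f ((shift ^^ n) \<omega>))"

definition level_set :: "(bitseq \<Rightarrow> real) \<Rightarrow> real \<Rightarrow> bitseq set" where
  "level_set f \<alpha> = {\<omega>. birkhoff_avg f \<omega> \<longlonglongrightarrow> \<alpha>}"

(* For continuous f the set below is nonempty (constant sequences have convergent averages) and
   bounded (f is bounded, as the sequence space is compact), so the real Sup is its actual
   least upper bound. *)
definition alpha_max :: "(bitseq \<Rightarrow> real) \<Rightarrow> real" where
  "alpha_max f = Sup {\<alpha>. level_set f \<alpha> \<noteq> {}}"

definition shift_periodic :: "bitseq \<Rightarrow> bool" where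
  "shift_periodic \<omega> \<longleftrightarrow> (\<exists>p\<ge>1. (shift ^^ p) \<omega> = \<omega>)"

end

theory Submission
  imports Defs
begin

text \<open>Let \<open>M\<close> be the largest average of \<open>f\<close> over a periodic orbit with period at most \<open>2 ^ k\<close>;
  only finitely many values compete. Among the first \<open>2 ^ k + 1\<close> windows of length \<open>k\<close> of any
  sequence two coincide. The loop between them is a periodic orbit, which contributes at most \<open>M\<close>
  times its length, and cutting it out leaves all other windows intact. Removing loops until at
  most \<open>2 ^ k\<close> terms are left bounds every Birkhoff sum of length \<open>N\<close> by \<open>N * M + C\<close>, so \<open>M\<close> is
  the supremum, and it is attained at a periodic point.\<close>

text \<open>Starting at the point itself, unlike \<open>birkhoff_avg\<close>, lets the sum split
  additively along an orbit; the offset reappears as \<open>shift x\<close> in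
  \<open>birkhoff_avg_eq\<close>.\<close>

definition birkhoff_sum :: "(bitseq \<Rightarrow> real) \<Rightarrow> nat \<Rightarrow> bitseq \<Rightarrow> real" where
  "birkhoff_sum f N x = (\<Sum>n<N. f ((shift ^^ n) x))"

lemma funpow_shift: "(shift ^^ n) x = (\<lambda>i. x (n + i))"
  by (induction n) (auto simp: shift_def)

lemma birkhoff_avg_eq: "birkhoff_avg f x N = birkhoff_sum f N (shift x) / real N"
proof -
  have "(\<Sum>n=1..N. f ((shift ^^ n) x)) = (\<Sum>n<N. f ((shift ^^ Suc n) x))"
    by (rule sum.reindex_bij_witness[of _ Suc "\<lambda>n. n - 1"]) auto
  then show ?thesis
    by (simp add: birkhoff_avg_def birkhoff_sum_def funpow_shift shift_def)
qed

lemma birkhoff_sum_add: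
  "birkhoff_sum f (m + n) x = birkhoff_sum f m x + birkhoff_sum f n ((shift ^^ m) x)"
  by (induction n) (auto simp: birkhoff_sum_def funpow_shift add_ac)

lemma birkhoff_sum_cong:
  assumes "\<And>n. n < N \<Longrightarrow> f ((shift ^^ n) x) = f ((shift ^^ n) y)"
  shows "birkhoff_sum f N x = birkhoff_sum f N y"
  using assms by (simp add: birkhoff_sum_def)

lemma birkhoff_sum_abs_le:
  assumes "\<And>x. \<bar>f x\<bar> \<le> K"
  shows "\<bar>birkhoff_sum f N x\<bar> \<le> real N * K"
proof -
  have "\<bar>birkhoff_sum f N x\<bar> \<le> (\<Sum>n<N. \<bar>f ((shift ^^ n) x)\<bar>)"
    unfolding birkhoff_sum_def by (rule sum_abs)
  also have "\<dots> \<le> (\<Sum>n<N. K)"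
    by (intro sum_mono assms)
  finally show ?thesis by simp
qed

text \<open>Controls leftover terms: an incomplete period in \<open>birkhoff_avg_periodic\<close>,
  the base case in \<open>birkhoff_sum_le\<close>.\<close>

lemma birkhoff_sum_diff_abs_le:
  assumes "\<And>x. \<bar>f x\<bar> \<le> K" and "N \<le> L"
  shows "\<bar>birkhoff_sum f N x - real N * M\<bar> \<le> real L * (K + \<bar>M\<bar>)"
proof -
  have K: "0 \<le> K" using assms(1)[of undefined] by linarith
  have "\<bar>birkhoff_sum f N x - real N * M\<bar> \<le> \<bar>birkhoff_sum f N x\<bar> + \<bar>real N * M\<bar>"
    by linarith
  also have "\<dots> \<le> real N * K + real N * \<bar>M\<bar>"
    using birkhoff_sum_abs_le[of f K N x] assms(1) by (simp add: abs_mult)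
  also have "\<dots> = real N * (K + \<bar>M\<bar>)" by (simp add: algebra_simps)
  also have "\<dots> \<le> real L * (K + \<bar>M\<bar>)"
    using K assms(2) by (intro mult_right_mono) auto
  finally show ?thesis .
qed

lemma birkhoff_sum_periodic:
  assumes "(shift ^^ p) x = x"
  shows "birkhoff_sum f (q * p + r) x = real q * birkhoff_sum f p x + birkhoff_sum f r x"
proof (induction q)
  case (Suc q)
  have "birkhoff_sum f (Suc q * p + r) x = birkhoff_sum f (p + (q * p + r)) x"
    by (simp add: add_ac)
  also have "\<dots> = birkhoff_sum f p x + birkhoff_sum f (q * p + r) x"
    by (simp only: birkhoff_sum_add assms)
  finally show ?case using Suc.IH by (simp add: algebra_simps)
qed simp

lemma tendsto_linear_plus_bounded:
  fixes a :: "nat \<Rightarrow> real"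
  assumes "\<And>N. \<bar>a N - real N * M\<bar> \<le> C"
  shows "(\<lambda>N. a N / real N) \<longlonglongrightarrow> M"
proof -
  have "(\<lambda>N. (a N - real N * M) / real N) \<longlonglongrightarrow> 0"
  proof (rule Lim_null_comparison)
    show "\<forall>\<^sub>F N in sequentially. norm ((a N - real N * M) / real N) \<le> C / real N"
      using assms by (intro always_eventually) (simp add: abs_divide divide_right_mono)
  qed (rule lim_const_over_n)
  then have "(\<lambda>N. (a N - real N * M) / real N + M) \<longlonglongrightarrow> 0 + M"
    by (intro tendsto_add tendsto_const)
  \<comment> \<open>Only eventually: at \<open>N = 0\<close> the sides are \<open>M\<close> and
    \<open>0\<close>.\<close>
  moreover have "\<forall>\<^sub>F N in sequentially. (a N - real N * M) / real N + M = a N / real N"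
    using eventually_gt_at_top[of 0] by eventually_elim (simp add: field_simps)
  ultimately show ?thesis
    by (simp add: filterlim_cong[OF refl refl])
qed

text \<open>Whole periods contribute exactly their mean, so the deviation comes from fewer than
  \<open>p\<close> leftover terms and stays bounded.\<close>

lemma birkhoff_avg_periodic:
  assumes "\<And>x. \<bar>f x\<bar> \<le> K" and "(shift ^^ p) x = x" and "p \<ge> 1"
  shows "birkhoff_avg f x \<longlonglongrightarrow> birkhoff_sum f p x / real p"
proof -
  define M where "M = birkhoff_sum f p x / real p"
  have bound: "\<bar>birkhoff_sum f N x - real N * M\<bar> \<le> real p * (K + \<bar>M\<bar>)" for N
  proof -
    have N: "N = N div p * p + N mod p" by simp
    have "birkhoff_sum f N x = real (N div p) * (real p * M) + birkhoff_sum f (N mod p) x"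
      using birkhoff_sum_periodic[OF assms(2), of f "N div p" "N mod p"] assms(3)
      by (simp add: M_def)
    moreover have "real N * M = real (N div p) * (real p * M) + real (N mod p) * M"
      by (subst N) (simp only: of_nat_add of_nat_mult algebra_simps)
    ultimately have "birkhoff_sum f N x - real N * M = birkhoff_sum f (N mod p) x - real (N mod p) * M"
      by simp
    then show ?thesis
      using birkhoff_sum_diff_abs_le[of f K "N mod p" p] assms by simp
  qed
  \<comment> \<open>Starting at \<open>shift x\<close> trades the term \<open>f x\<close> for
    \<open>f ((shift ^^ N) x)\<close>, which costs at most \<open>2 * K\<close>.\<close>
  have "\<bar>birkhoff_sum f N (shift x) - real N * M\<bar> \<le> real p * (K + \<bar>M\<bar>) + 2 * K" for N
  proof -
    have "birkhoff_sum f (1 + N) x = birkhoff_sum f (N + 1) x" by simp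
    then have "f x + birkhoff_sum f N (shift x) = birkhoff_sum f N x + f ((shift ^^ N) x)"
      unfolding birkhoff_sum_add by (simp add: birkhoff_sum_def)
    then show ?thesis
      using bound[of N] assms(1)[of x] assms(1)[of "(shift ^^ N) x"] by linarith
  qed
  then have "(\<lambda>N. birkhoff_sum f N (shift x) / real N) \<longlonglongrightarrow> M"
    by (rule tendsto_linear_plus_bounded)
  then show ?thesis
    by (simp add: birkhoff_avg_eq[abs_def] M_def)
qed

text \<open>Every value is already taken at the indicator of some subset of
  \<open>{..<m}\<close>.\<close>

lemma finite_range_finitely_many_coordinates:
  fixes g :: "bitseq \<Rightarrow> 'a"
  assumes "\<And>x y. (\<And>i. i < m \<Longrightarrow> x i = y i) \<Longrightarrow> g x = g y"
  shows "finite (range g)"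
proof (rule finite_subset)
  show "range g \<subseteq> (\<lambda>A. g (\<lambda>i. i \<in> A)) ` Pow {..<m}"
  proof
    fix v assume "v \<in> range g"
    then obtain x where "v = g x" by blast
    also have "g x = g (\<lambda>i. i \<in> {j. j < m \<and> x j})"
      by (rule assms) simp
    finally show "v \<in> (\<lambda>A. g (\<lambda>i. i \<in> A)) ` Pow {..<m}" by blast
  qed
qed simp

lemma PCC_D:
  assumes "f \<in> PCC k" and "\<And>i. i < k \<Longrightarrow> x i = y i"
  shows "f x = f y"
  using assms unfolding PCC_def by blast

text \<open>Windows of length \<open>k\<close> starting before \<open>N\<close> see only the first
  \<open>N + k\<close> coordinates.\<close>

lemma finite_range_birkhoff_sum:
  assumes "f \<in> PCC k"
  shows "finite (range (birkhoff_sum f N))"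
  by (rule finite_range_finitely_many_coordinates[of "N + k"])
     (intro birkhoff_sum_cong PCC_D[OF assms], simp add: funpow_shift)

lemma windows_coincide:
  fixes x :: bitseq
  obtains i j where "i < j" "j \<le> 2 ^ k" "\<And>l. l < k \<Longrightarrow> x (i + l) = x (j + l)"
proof -
  \<comment> \<open>A window is coded by the set of offsets where it is true, so at most
    \<open>2 ^ k\<close> codes face \<open>2 ^ k + 1\<close> starting positions.\<close>
  define w where "w n = {l. l < k \<and> x (n + l)}" for n
  have "card (w ` {..2 ^ k}) \<le> card (Pow {..<k})"
    by (rule card_mono) (auto simp: w_def)
  then have "card (w ` {..2 ^ k}) < card {..(2::nat) ^ k}"
    by (simp add: card_Pow)
  then have "\<not> inj_on w {..2 ^ k}" by (rule pigeonhole)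
  then obtain i j where ij: "i \<le> 2 ^ k" "j \<le> 2 ^ k" "i \<noteq> j" "w i = w j"
    by (auto simp: inj_on_def)
  have eq: "x (i + l) = x (j + l)" if "l < k" for l
    using ij(4) that unfolding w_def by blast
  show ?thesis
    using that[of i j] that[of j i] ij eq by (cases "i < j") auto
qed

text \<open>The first \<open>p + k\<close> coordinates of \<open>x\<close> already have period
  \<open>p\<close>, and the \<open>p\<close> summands see no others; so \<open>x\<close> may be
  replaced by the periodic repetition of its first \<open>p\<close> coordinates.\<close>

lemma birkhoff_sum_loop:
  assumes f: "f \<in> PCC k" and "p \<ge> 1" and coincide: "\<And>l. l < k \<Longrightarrow> x l = x (p + l)"
  shows "\<exists>z. (shift ^^ p) z = z \<and> birkhoff_sum f p x = birkhoff_sum f p z"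
proof (intro exI conjI)
  define z where "z = (\<lambda>m. x (m mod p))"
  show "(shift ^^ p) z = z" by (simp add: funpow_shift z_def)
  \<comment> \<open>Since \<open>p\<close> may be smaller than \<open>k\<close>, one step back by
    \<open>p\<close> need not land below \<open>p\<close>; hence the strong induction.\<close>
  have eq: "x m = z m" if "m < p + k" for m
    using that
  proof (induction m rule: less_induct)
    case (less m)
    show ?case
    proof (cases "m < p")
      case False
      then have "x m = x (m - p)" using coincide[of "m - p"] less.prems by simp
      also have "\<dots> = z (m - p)" using less False \<open>p \<ge> 1\<close> by simp
      also have "\<dots> = z m" using False by (simp add: z_def le_mod_geq)
      finally show ?thesis .
    qed (simp add: z_def)
  qed
  show "birkhoff_sum f p x = birkhoff_sum f p z"
    by (intro birkhoff_sum_cong PCC_D[OF f]) (simp add: funpow_shift eq)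
qed

lemma birkhoff_sum_cut:
  assumes f: "f \<in> PCC k" and coincide: "\<And>l. l < k \<Longrightarrow> x (i + l) = x (i + p + l)"
  shows "\<exists>y. birkhoff_sum f (i + p + n) x = birkhoff_sum f p ((shift ^^ i) x) + birkhoff_sum f (i + n) y"
proof
  \<comment> \<open>Coordinates \<open>i\<close> to \<open>i + p - 1\<close> are deleted.\<close>
  define y where "y = (\<lambda>m. if m < i then x m else x (m + p))"
  have "birkhoff_sum f i x = birkhoff_sum f i y"
  proof (intro birkhoff_sum_cong PCC_D[OF f])
    fix m l assume "m < i" "l < k"
    \<comment> \<open>If the window crosses the cut, its offset \<open>m + l - i\<close> past the
      cut is below \<open>k\<close>, where both continuations agree.\<close>
    then show "(shift ^^ m) x l = (shift ^^ m) y l"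
      using coincide[of "m + l - i"] by (auto simp: funpow_shift y_def add_ac)
  qed
  moreover have "(shift ^^ (i + p)) x = (shift ^^ i) y"
    by (simp add: funpow_shift y_def add_ac)
  ultimately show "birkhoff_sum f (i + p + n) x =
      birkhoff_sum f p ((shift ^^ i) x) + birkhoff_sum f (i + n) y"
    by (simp add: birkhoff_sum_add)
qed

text \<open>Strong induction on \<open>N\<close>: each removed loop of length \<open>p\<close> costs
  at most \<open>p * M\<close>, so the additive constant is paid only once, in the base
  case.\<close>

lemma birkhoff_sum_le:
  assumes f: "f \<in> PCC k" and K: "\<And>x. \<bar>f x\<bar> \<le> K"
    and M: "\<And>p z. \<lbrakk>1 \<le> p; p \<le> 2 ^ k; (shift ^^ p) z = z\<rbrakk> \<Longrightarrow> birkhoff_sum f p z \<le> real p * M"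
  shows "birkhoff_sum f N x \<le> real N * M + 2 ^ k * (K + \<bar>M\<bar>)"
proof (induction N arbitrary: x rule: less_induct)
  case (less N)
  show ?case
  proof (cases "N \<le> 2 ^ k")
    case True
    then show ?thesis
      using birkhoff_sum_diff_abs_le[of f K, OF K True, of x M] by (simp add: abs_le_iff)
  next
    case False
    obtain i j where ij: "i < j" "j \<le> 2 ^ k" "\<And>l. l < k \<Longrightarrow> x (i + l) = x (j + l)"
      using windows_coincide by blast
    define p where "p = j - i"
    have p: "1 \<le> p" "p \<le> 2 ^ k" "j = i + p" using ij by (auto simp: p_def)
    define n where "n = N - j"
    \<comment> \<open>As \<open>j \<le> 2 ^ k < N\<close>, the loop lies within the first
      \<open>N\<close> terms.\<close>
    have N: "N = i + p + n" using False ij p by (simp add: n_def)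
    obtain y where y: "birkhoff_sum f N x = birkhoff_sum f p ((shift ^^ i) x) + birkhoff_sum f (i + n) y"
      using birkhoff_sum_cut[OF f, of x i p n] ij(3) unfolding N p(3) by blast
    obtain z where "(shift ^^ p) z = z" "birkhoff_sum f p ((shift ^^ i) x) = birkhoff_sum f p z"
      using birkhoff_sum_loop[OF f p(1), of "(shift ^^ i) x"] ij(3)
      by (auto simp: funpow_shift p(3) add.assoc)
    then have "birkhoff_sum f p ((shift ^^ i) x) \<le> real p * M"
      using M p by simp
    moreover have "birkhoff_sum f (i + n) y \<le> real (i + n) * M + 2 ^ k * (K + \<bar>M\<bar>)"
      using p N by (intro less.IH) simp
    ultimately show ?thesis unfolding y by (simp add: N algebra_simps)
  qed
qed

theorem lemma3p2p3:
  fixes k :: nat and f :: "bitseq \<Rightarrow> real"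
  assumes "k \<ge> 1" and "f \<in> PCC k"
  shows "\<exists>\<omega>. shift_periodic \<omega> \<and> birkhoff_avg f \<omega> \<longlonglongrightarrow> alpha_max f"
proof -
  have "finite (range f)"
    by (rule finite_range_finitely_many_coordinates) (rule PCC_D[OF assms(2)])
  then obtain K where K: "\<And>x. \<bar>f x\<bar> \<le> K"
    using finite_imp_bounded[of "range f"] by (auto simp: bounded_iff)
  define P where "P = (\<Union>p\<in>{1..2 ^ k}. (\<lambda>z. birkhoff_sum f p z / real p) ` {z. (shift ^^ p) z = z})"
  define M where "M = Max P"
  have "finite ((\<lambda>z. birkhoff_sum f p z / real p) ` {z. (shift ^^ p) z = z})" for p
    by (rule finite_subset[OF _ finite_imageI[OF finite_range_birkhoff_sum[OF assms(2), of p],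
          of "\<lambda>v. v / real p"]]) auto
  then have "finite P" by (simp add: P_def)
  \<comment> \<open>A fixed point makes \<open>P\<close> nonempty, so \<open>Max P\<close> is
    attained.\<close>
  moreover have "birkhoff_sum f 1 (\<lambda>_. False) / real 1 \<in> P"
    unfolding P_def by (intro UN_I[of 1] imageI) (auto simp: funpow_shift shift_def)
  ultimately have "M \<in> P" and le_M: "\<And>v. v \<in> P \<Longrightarrow> v \<le> M"
    unfolding M_def by (auto intro: Max_in)
  then obtain p z where p: "1 \<le> p" and z: "(shift ^^ p) z = z" and Mz: "M = birkhoff_sum f p z / real p"
    by (auto simp: P_def)
  have lim: "birkhoff_avg f z \<longlonglongrightarrow> M"
    unfolding Mz using K z p by (rule birkhoff_avg_periodic)
  have loops: "birkhoff_sum f q w \<le> real q * M" if "1 \<le> q" "q \<le> 2 ^ k" "(shift ^^ q) w = w" for q w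
  proof -
    have "birkhoff_sum f q w / real q \<in> P"
      using that unfolding P_def by auto
    from le_M[OF this] show ?thesis using that by (simp add: field_simps)
  qed
  define C where "C = 2 ^ k * (K + \<bar>M\<bar>)"
  have "\<alpha> \<le> M" if "birkhoff_avg f x \<longlonglongrightarrow> \<alpha>" for \<alpha> x
  proof (rule tendsto_le[OF sequentially_bot _ that])
    show "(\<lambda>N. (real N * M + C) / real N) \<longlonglongrightarrow> M"
      by (rule tendsto_linear_plus_bounded[where C = "\<bar>C\<bar>"]) simp
    have "birkhoff_avg f x N \<le> (real N * M + C) / real N" for N
      unfolding birkhoff_avg_eq C_def
      by (rule divide_right_mono[OF birkhoff_sum_le[of f k K M, OF assms(2) K loops]]) simp_all
    then show "\<forall>\<^sub>F N in sequentially. birkhoff_avg f x N \<le> (real N * M + C) / real N"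
      by simp
  qed
  \<comment> \<open>The orbit of \<open>z\<close> realizes the upper bound \<open>M\<close>, so the
    supremum is a maximum.\<close>
  then have "alpha_max f = M"
    unfolding alpha_max_def level_set_def using lim by (intro cSup_eq_maximum) auto
  with lim z p show ?thesis
    unfolding shift_periodic_def by blast
qed

end
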